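(* Let $k\ge 1$ be an integer. The joint spectral measure (over $\mathbb{T}^2$) of the graphs $\mathcal{A}^{\rho_x}_k(Sp(2))$, $\mathcal{A}^{\rho_y}_k(Sp(2))$ is given by $$\mathrm{d}\varepsilon_{x,y}(\omega_1,\omega_2)=\frac{1}{128\pi^4}\,J_{x,y}(\omega_1,\omega_2)^2\,\mathrm{d}_{2(k+3)}\omega_1\,\mathrm{d}_{2(k+3)}\omega_2,$$ where $\mathrm{d}_m$ is the uniform Dirac (probability) measure over the $m$-th roots of unity.
   Context: Fix the level $k$ and put $\kappa=k+3$, $\xi=\pi/2\kappa$. Let $P_+^k=\{(\lambda_1,\lambda_2)\in\mathbb{Z}^2:\lambda_1,\lambda_2\ge 0,\ \lambda_1+\lambda_2\le k\}$ (Dynkin labels of the level $k$ integrable representations of $Sp(2)$; $\rho_x=(1,0)$ corresponds to the 4-dimensional and $\rho_y=(0,1)$ to the 5-dimensional representation of $Sp(2)$). With $\hat\lambda_i=\lambda_i+1$, $\hat\mu_i=\mu_i+1$, the modular $S$-matrix is the real symmetric unitary matrix indexed by $P_+^k$: $$S_{\lambda,\mu}=\frac1\kappa\Big[\cos(\xi((\hat\lambda_1+2\hat\lambda_2)(\hat\mu_1+2\hat\mu_2)+\hat\lambda_1\hat\mu_1))-\cos(\xi((\hat\lambda_1+2\hat\lambda_2)(\hat\mu_1+2\hat\mu_2)-\hat\lambda_1\hat\mu_1))$$ $$\qquad+\cos(\xi((\hat\lambda_1+2\hat\lambda_2)\hat\mu_1-\hat\lambda_1(\hat\mu_1+2\hat\mu_2)))-\cos(\xi((\hat\lambda_1+2\hat\lambda_2)\hat\mu_1+\hat\lambda_1(\hat\mu_1+2\hat\mu_2)))\Big].$$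 For $\lambda\in P_+^k$ the fusion matrix $N_\lambda$ is $(N_\lambda)_{\mu\nu}=\sum_{\sigma\in P_+^k}\frac{S_{\sigma,\lambda}}{S_{\sigma,0}}S_{\sigma,\mu}\overline{S_{\sigma,\nu}}$, with $0=(0,0)$ (the Verlinde formula for $Sp(2)$ at level $k$). The graph $\mathcal{A}^{\rho_u}_k(Sp(2))$, $u=x,y$, is the graph with vertex set $P_+^k$ and adjacency matrix $N_{\rho_u}$; its distinguished vertex is $\ast=(0,0)$, with basis vector $e_\ast\in\ell^2(P_+^k)$. On $\mathbb{T}^2$ put $\chi_{\rho_x}(\omega_1,\omega_2)=\omega_1+\omega_1^{-1}+\omega_2+\omega_2^{-1}$ and $\chi_{\rho_y}(\omega_1,\omega_2)=1+\omega_1\omega_2+\omega_1^{-1}\omega_2^{-1}+\omega_1\omega_2^{-1}+\omega_1^{-1}\omega_2$. The Weyl group $D_8$ (dihedral of order 8) acts on $\mathbb{T}^2$, generated by $(\omega_1,\omega_2)\mapsto(\omega_2,\omega_1)$ and $(\omega_1,\omega_2)\mapsto(\omega_2,\omega_1^{-1})$. The joint spectral measure over $\mathbb{T}^2$ is the $D_8$-invariant measure $\varepsilon_{x,y}$ on $\mathbb{T}^2$ with $$\int_{\mathbb{T}^2}\chi_{\rho_x}^m\,\chi_{\rho_y}^n\,\mathrm{d}\varepsilon_{x,y}=\langle N_{\rho_x}^mN_{\rho_y}^n e_\ast,e_\ast\rangle\quad\text{for all }m,n\ge0.$$ With $\omega_j=e^{2\pi i\theta_j}$, $$J_{x,y}=8\pi^2\big(\cos2\pi(\theta_1+2\theta_2)+\cos2\pi(2\theta_1-\theta_2)-\cos2\pi(2\theta_1+\theta_2)-\cos2\pi(\theta_1-2\theta_2)\big),$$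 the Jacobian $\det(\partial(\chi_{\rho_x},\chi_{\rho_y})/\partial(\theta_1,\theta_2))$. *)

theory Defs
  imports "HOL-Analysis.Analysis"
begin

type_synonym weight = "int \<times> int"

definition P_plus :: "nat \<Rightarrow> weight set" where
  "P_plus k = {(l1, l2). 0 \<le> l1 \<and> 0 \<le> l2 \<and> l1 + l2 \<le> int k}"

definition rho_x :: weight where "rho_x = (1, 0)"
definition rho_y :: weight where "rho_y = (0, 1)"
definition vac :: weight where "vac = (0, 0)"

definition S_mat :: "nat \<Rightarrow> weight \<Rightarrow> weight \<Rightarrow> real" where
  "S_mat k l m =
    (let \<kappa> = real k + 3; \<xi> = pi / (2 * \<kappa>);
         l1 = of_int (fst l) + 1; l2 = of_int (snd l) + 1;
         m1 = of_int (fst m) + 1; m2 = of_int (snd m) + 1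
     in 1 / \<kappa> *
        (cos (\<xi> * ((l1 + 2 * l2) * (m1 + 2 * m2) + l1 * m1))
       - cos (\<xi> * ((l1 + 2 * l2) * (m1 + 2 * m2) - l1 * m1))
       + cos (\<xi> * ((l1 + 2 * l2) * m1 - l1 * (m1 + 2 * m2)))
       - cos (\<xi> * ((l1 + 2 * l2) * m1 + l1 * (m1 + 2 * m2)))))"

definition fusion :: "nat \<Rightarrow> weight \<Rightarrow> weight \<Rightarrow> weight \<Rightarrow> complex" where
  "fusion k l m n =
    (\<Sum>s\<in>P_plus k. complex_of_real (S_mat k s l) / complex_of_real (S_mat k s vac)
       * complex_of_real (S_mat k s m) * cnj (complex_of_real (S_mat k s n)))"

record 'v pointed_graph =
  gverts :: "'v set"
  gadj :: "'v \<Rightarrow> 'v \<Rightarrow> complex"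
  gstar :: 'v

definition A_graph :: "nat \<Rightarrow> weight \<Rightarrow> weight pointed_graph" where
  "A_graph k r = \<lparr> gverts = P_plus k, gadj = fusion k r, gstar = vac \<rparr>"

definition adj_op :: "'v pointed_graph \<Rightarrow> ('v \<Rightarrow> complex) \<Rightarrow> 'v \<Rightarrow> complex" where
  "adj_op G f = (\<lambda>v. \<Sum>w\<in>gverts G. gadj G v w * f w)"

definition star_vec :: "'v pointed_graph \<Rightarrow> 'v \<Rightarrow> complex" where
  "star_vec G = (\<lambda>v. if v = gstar G then 1 else 0)"

text \<open>Two graphs with the same vertices and distinguished vertex are intended; both are
  read off from the first argument.\<close>

definition joint_moment :: "'v pointed_graph \<Rightarrow> 'v pointed_graph \<Rightarrow> nat \<Rightarrow> nat \<Rightarrow> complex" where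
  "joint_moment G H m n =
    (\<Sum>v\<in>gverts G.
       ((adj_op G ^^ m) ((adj_op H ^^ n) (star_vec G))) v * cnj (star_vec G v))"

definition circle_borel :: "complex measure" where
  "circle_borel = restrict_space borel (sphere 0 1)"

definition torus_borel :: "(complex \<times> complex) measure" where
  "torus_borel = circle_borel \<Otimes>\<^sub>M circle_borel"

definition chi_x :: "complex \<times> complex \<Rightarrow> complex" where
  "chi_x = (\<lambda>(w1, w2). w1 + inverse w1 + w2 + inverse w2)"

definition chi_y :: "complex \<times> complex \<Rightarrow> complex" where
  "chi_y = (\<lambda>(w1, w2). 1 + w1 * w2 + inverse w1 * inverse w2 + w1 * inverse w2 + inverse w1 * w2)"

text \<open>Both generators have finite order, so the generated monoid is the generated group.\<close>

inductive_set weyl_D8 :: "(complex \<times> complex \<Rightarrow> complex \<times> complex) set" where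
  one: "id \<in> weyl_D8"
| swap: "g \<in> weyl_D8 \<Longrightarrow> (\<lambda>(w1, w2). (w2, w1)) \<circ> g \<in> weyl_D8"
| rot: "g \<in> weyl_D8 \<Longrightarrow> (\<lambda>(w1, w2). (w2, inverse w1)) \<circ> g \<in> weyl_D8"

definition D8_invariant :: "(complex \<times> complex) measure \<Rightarrow> bool" where
  "D8_invariant M \<longleftrightarrow> (\<forall>g\<in>weyl_D8. distr M M g = M)"

definition is_joint_spectral_measure ::
    "'v pointed_graph \<Rightarrow> 'v pointed_graph \<Rightarrow> (complex \<times> complex) measure \<Rightarrow> bool" where
  "is_joint_spectral_measure G H M \<longleftrightarrow>
     sets M = sets torus_borel \<and> finite_measure M \<and> D8_invariant M \<and>
     (\<forall>m n. (\<integral>w. chi_x w ^ m * chi_y w ^ n \<partial>M) = joint_moment G H m n)"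

definition J_theta :: "real \<Rightarrow> real \<Rightarrow> real" where
  "J_theta t1 t2 = 8 * pi\<^sup>2 *
     (cos (2 * pi * (t1 + 2 * t2)) + cos (2 * pi * (2 * t1 - t2))
      - cos (2 * pi * (2 * t1 + t2)) - cos (2 * pi * (t1 - 2 * t2)))"

lemma chi_x_cis:
  "chi_x (cis (2 * pi * t1), cis (2 * pi * t2)) =
     of_real (2 * cos (2 * pi * t1) + 2 * cos (2 * pi * t2))"
  by (simp add: chi_x_def complex_eq_iff)

lemma chi_y_cis:
  "chi_y (cis (2 * pi * t1), cis (2 * pi * t2)) =
     of_real (1 + 4 * cos (2 * pi * t1) * cos (2 * pi * t2))"
  by (simp add: chi_y_def complex_eq_iff algebra_simps)

lemma J_theta_jacobian:
  fixes t1 t2 :: real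
  defines "X \<equiv> \<lambda>s t. Re (chi_x (cis (2 * pi * s), cis (2 * pi * t)))"
    and "Y \<equiv> \<lambda>s t. Re (chi_y (cis (2 * pi * s), cis (2 * pi * t)))"
  shows "J_theta t1 t2 =
    deriv (\<lambda>s. X s t2) t1 * deriv (\<lambda>t. Y t1 t) t2
    - deriv (\<lambda>t. X t1 t) t2 * deriv (\<lambda>s. Y s t2) t1"
proof -
  have d1: "deriv (\<lambda>s. X s t2) t1 = - 4 * pi * sin (2 * pi * t1)"
    unfolding X_def chi_x_cis Re_complex_of_real
    by (rule DERIV_imp_deriv) (auto intro!: derivative_eq_intros)
  have d2: "deriv (\<lambda>t. X t1 t) t2 = - 4 * pi * sin (2 * pi * t2)"
    unfolding X_def chi_x_cis Re_complex_of_real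
    by (rule DERIV_imp_deriv) (auto intro!: derivative_eq_intros)
  have d3: "deriv (\<lambda>s. Y s t2) t1 = - 8 * pi * sin (2 * pi * t1) * cos (2 * pi * t2)"
    unfolding Y_def chi_y_cis Re_complex_of_real
    by (rule DERIV_imp_deriv) (auto intro!: derivative_eq_intros)
  have d4: "deriv (\<lambda>t. Y t1 t) t2 = - 8 * pi * cos (2 * pi * t1) * sin (2 * pi * t2)"
    unfolding Y_def chi_y_cis Re_complex_of_real
    by (rule DERIV_imp_deriv) (auto intro!: derivative_eq_intros)
  define a where "a = 2 * pi * t1"
  define b where "b = 2 * pi * t2"
  have J: "J_theta t1 t2 =
      8 * pi\<^sup>2 * (cos (a + 2 * b) + cos (2 * a - b) - cos (2 * a + b) - cos (a - 2 * b))"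
    unfolding J_theta_def a_def b_def by (simp add: algebra_simps)
  show ?thesis
    unfolding d1 d2 d3 d4 J a_def[symmetric] b_def[symmetric]
    unfolding cos_add cos_diff sin_double by (simp add: power2_eq_square algebra_simps)
qed

definition J_xy :: "complex \<times> complex \<Rightarrow> real" where
  "J_xy = (\<lambda>(w1, w2). J_theta (Arg2pi w1 / (2 * pi)) (Arg2pi w2 / (2 * pi)))"

text \<open>The choice of the branch of the argument is immaterial.\<close>

lemma J_xy_cis: "J_xy (cis (2 * pi * t1), cis (2 * pi * t2)) = J_theta t1 t2"
proof -
  define F where "F = (\<lambda>z w. 8 * pi\<^sup>2 *
     (Re (z * w ^ 2) + Re (z ^ 2 * cnj w) - Re (z ^ 2 * w) - Re (z * cnj w ^ 2)))"
  have F: "J_theta s t = F (cis (2 * pi * s)) (cis (2 * pi * t))" for s t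
    unfolding F_def J_theta_def
    by (simp only: cis_cnj Complex.DeMoivre cis_mult) (simp add: algebra_simps)
  have A: "cis (2 * pi * (Arg2pi (cis a) / (2 * pi))) = cis a" for a
    using Arg2pi_eq[of "cis a"] by (simp add: cis_conv_exp)
  show ?thesis
    unfolding J_xy_def by (simp only: prod.case F A)
qed

definition dirac_roots :: "nat \<Rightarrow> complex measure" where
  "dirac_roots m = distr (uniform_count_measure {z. z ^ m = 1}) circle_borel (\<lambda>z. z)"

end

theory Submission
  imports Defs
begin

text \<open>
  The modular matrix diagonalizes the fusion matrices. In suitable integer coordinates on the weights
  it is, up to sign and normalization, the exterior square of the discrete sine transform of size
  \<open>k + 2\<close> (\<open>S_mat_weight_of\<close>), so the Cauchy--Binet formula makes it orthogonal
  (\<open>S_mat_orthogonal_columns\<close>). Therefore a joint moment of the two graphs is the sum over all weights of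
  the squared vacuum entry times powers of the two eigenvalues (\<open>joint_moment_spectral\<close>).

  The eigenvalues are the characters at the torus point with angles \<open>pi * x / (k + 3)\<close> and
  \<open>pi * y / (k + 3)\<close>, and the vacuum entry is a multiple of the Weyl denominator there, which
  is also the Jacobian up to a constant (\<open>J_xy_on_torus\<close>). The squared Jacobian is invariant under the
  Weyl group and vanishes on the mirrors, so the sum over the weights unfolds to a sum over all pairs of
  roots of unity of order \<open>2 * (k + 3)\<close> (\<open>joint_moment_sum\<close>), which is the integral against the
  asserted measure (\<open>jacobian_measure_moment\<close>).

  Conversely, the asserted measure is the only invariant one with these moments
  (\<open>D8_invariant_measure_determined\<close>). Its finite support makes this an algebraic fact:
  a nonnegative polynomial in the characters that vanishes on the support must vanish almost everywhere
  for any measure with the same moments, so that measure lives on finitely many orbits.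
  The characters separate orbits (\<open>orbit_eq_fibre\<close>), so polynomials isolate a single orbit, and invariance
  spreads its mass evenly.
\<close>

section \<open>Orthogonality of sines on a finite cyclic group\<close>

lemma sum_cos_period:
  fixes N :: nat and n :: int
  assumes "N > 0" and "\<not> int N dvd n"
  shows "(\<Sum>j<N. cos (2 * pi * (of_int n * real j) / real N)) = 0"
proof -
  define z where "z = cis (2 * pi * of_int n / real N)"
  have "z \<noteq> 1"
  proof
    assume "z = 1"
    then have "cos (2 * pi * of_int n / real N) = 1"
      unfolding z_def by (metis cis.sel(1) one_complex.sel(1))
    then obtain m :: int where "2 * pi * of_int n / real N = of_int m * 2 * pi"
      using cos_one_2pi_int by blast
    then have "real_of_int n = of_int (m * int N)"
      using assms(1) by (simp add: field_simps)
    then have "n = m * int N"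
      by linarith
    with assms(2) show False
      by simp
  qed
  have pow: "z ^ j = cis (2 * pi * (of_int n * real j) / real N)" for j
    unfolding z_def Complex.DeMoivre by (simp add: algebra_simps)
  have "z ^ N = 1"
    unfolding pow using assms(1) by (simp add: cis_multiple_2pi[of "of_int n", simplified mult.assoc] mult.assoc)
  then have "(\<Sum>j<N. z ^ j) = 0"
    using \<open>z \<noteq> 1\<close> by (simp add: geometric_sum)
  then have "Re (\<Sum>j<N. z ^ j) = 0"
    by simp
  then show ?thesis
    by (simp add: pow)
qed

lemma sum_union3:
  assumes "finite A" "finite B" "finite C" "A \<inter> B = {}" "A \<inter> C = {}" "B \<inter> C = {}"
  shows "sum f (A \<union> (B \<union> C)) = sum f A + (sum f B + sum f C)"
  using assms by (simp add: sum.union_disjoint Int_Un_distrib)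

text \<open>The reflection \<open>j \<mapsto> 2 * K - j\<close> of the integers modulo \<open>2 * K\<close> fixes only \<open>0\<close> and
  \<open>K\<close>, where \<open>f\<close> vanishes; all other residues come in equal pairs.\<close>

lemma sum_fold_even:
  fixes f :: "nat \<Rightarrow> real"
  assumes "f 0 = 0" "f K = 0" and "\<And>j. j < K \<Longrightarrow> f (2 * K - j) = f j"
  shows "(\<Sum>j<2 * K. f j) = 2 * (\<Sum>j=1..<K. f j)"
proof (cases "K = 0")
  case False
  \<comment> \<open>The two fixed points of the reflection, and the two halves that it exchanges.\<close>
  have split: "{..<2 * K} = {0, K} \<union> ({1..<K} \<union> {K + 1..<2 * K})"
    using False by auto
  have upper: "f (2 * K - j) = f j" if "K < j" "j < 2 * K" for j
    using assms(3)[of "2 * K - j"] that by simp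
  have "(\<Sum>j=K+1..<2*K. f j) = (\<Sum>j=1..<K. f j)"
    by (rule sum.reindex_bij_witness[of _ "\<lambda>j. 2 * K - j" "\<lambda>j. 2 * K - j"])
       (auto simp: upper)
  moreover have "(\<Sum>j<2 * K. f j) = (\<Sum>j\<in>{0, K}. f j) + ((\<Sum>j=1..<K. f j) + (\<Sum>j=K+1..<2*K. f j))"
    unfolding split using False by (intro sum_union3) auto
  ultimately show ?thesis
    using assms(1,2) False by simp
qed simp

text \<open>The matrix of the discrete sine transform of size \<open>K - 1\<close> (without normalization).\<close>

definition sn :: "nat \<Rightarrow> nat \<Rightarrow> nat \<Rightarrow> real" where
  "sn K i j = sin (pi * (real i * real j) / real K)"

text \<open>Expand the product of sines into cosines and extend the range to the full period
  \<open>{..<2 * K}\<close>: over a full period every nonconstant cosine sums to zero, and for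
  \<open>a\<close> and \<open>b\<close> strictly between \<open>0\<close> and \<open>K\<close> only the frequency \<open>a - b = 0\<close> is constant.\<close>

lemma sn_orthogonal:
  assumes "0 < a" "a < K" "0 < b" "b < K"
  shows "(\<Sum>j=1..<K. sn K j a * sn K j b) = (if a = b then real K / 2 else 0)"
proof -
  define f where "f j = sn K j a * sn K j b" for j
  have K: "K > 0"
    using assms by simp
  \<comment> \<open>Each sine is odd under the reflection, so the product of two is even.\<close>
  have refl: "sn K (2 * K - j) c = - sn K j c" if "j < K" for j c
  proof -
    have "pi * (real (2 * K - j) * real c) / real K = 2 * pi * of_int (int c) - pi * (real j * real c) / real K"
      using that by (simp add: field_simps of_nat_diff)
    then show ?thesis
      unfolding sn_def by (simp only: sin_diff sin_int_2pin cos_int_2pin)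
  qed
  have van: "sn K K c = 0" for c
    unfolding sn_def using K by (simp add: sin_npi2)
  have prod: "f j = (cos (2 * pi * (of_int (int a - int b) * real j) / real (2 * K)) -
      cos (2 * pi * (of_int (int a + int b) * real j) / real (2 * K))) / 2" for j
    unfolding f_def sn_def sin_times_sin
    by (simp add: algebra_simps add_divide_distrib diff_divide_distrib)
  have c2: "(\<Sum>j<2 * K. cos (2 * pi * (of_int (int a + int b) * real j) / real (2 * K))) = 0"
    by (rule sum_cos_period) (use assms zdvd_not_zless[of "int a + int b" "int (2 * K)"] in auto)
  have c1: "(\<Sum>j<2 * K. cos (2 * pi * (of_int (int a - int b) * real j) / real (2 * K))) =
      (if a = b then 2 * real K else 0)"
  proof (cases "a = b")
    case False
    have "\<not> int (2 * K) dvd (int a - int b)"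
      using False assms dvd_imp_le_int[of "int a - int b" "int (2 * K)"] by auto
    then show ?thesis
      using sum_cos_period[of "2 * K" "int a - int b"] K False by simp
  qed simp
  have "2 * (\<Sum>j=1..<K. f j) = (\<Sum>j<2 * K. f j)"
    by (rule sum_fold_even[symmetric]) (simp_all add: f_def refl van, simp add: sn_def)
  also have "\<dots> = (if a = b then real K else 0)"
    unfolding prod sum_divide_distrib[symmetric] sum_subtractf c1 c2 by simp
  finally show ?thesis
    unfolding f_def by (simp split: if_splits)
qed

section \<open>The modular matrix as an exterior square of the sine transform\<close>

text \<open>Dynkin labels are traded for the shifted orthogonal coordinates
  \<open>x = \<lambda>\<^sub>1 + \<lambda>\<^sub>2 + 2\<close> and \<open>y = \<lambda>\<^sub>2 + 1\<close>: the level \<open>k\<close> weights become the integer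
  points of this open triangle with \<open>K = k + 3\<close>, the interior of a fundamental domain for coordinate swap and
  sign changes modulo \<open>2 * K\<close>.\<close>

definition alcove :: "nat \<Rightarrow> (nat \<times> nat) set" where
  "alcove K = {(x, y). 0 < y \<and> y < x \<and> x < K}"

lemma finite_alcove [simp]: "finite (alcove K)"
  by (rule finite_subset[of _ "{..<K} \<times> {..<K}"]) (auto simp: alcove_def)

text \<open>The square without its diagonal consists of the alcove and its mirror image.\<close>

lemma sum_alcove:
  fixes F :: "nat \<Rightarrow> nat \<Rightarrow> real"
  assumes "\<And>x y. F x y = F y x" and "\<And>x. F x x = 0"
  shows "2 * (\<Sum>(x, y)\<in>alcove K. F x y) = (\<Sum>x=1..<K. \<Sum>y=1..<K. F x y)"
proof -
  define D where "D = {(x, y). x = y \<and> 0 < x \<and> x < K}"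
  have D: "finite D" "(\<Sum>(x, y)\<in>D. F x y) = 0"
    by (rule finite_subset[of _ "{..<K} \<times> {..<K}"]) (auto simp: D_def assms(2) intro!: sum.neutral)
  have swap: "(\<Sum>(x, y)\<in>prod.swap ` alcove K. F x y) = (\<Sum>(x, y)\<in>alcove K. F x y)"
    by (subst sum.reindex) (auto intro!: sum.cong assms(1))
  have box: "{1..<K} \<times> {1..<K} = alcove K \<union> (prod.swap ` alcove K \<union> D)"
    by (auto simp: alcove_def D_def image_iff)
  have "(\<Sum>(x, y)\<in>{1..<K} \<times> {1..<K}. F x y) = (\<Sum>(x, y)\<in>alcove K. F x y) +
      ((\<Sum>(x, y)\<in>prod.swap ` alcove K. F x y) + (\<Sum>(x, y)\<in>D. F x y))"
    unfolding box by (rule sum_union3) (use D(1) in simp_all, auto simp: alcove_def D_def)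
  then show ?thesis
    by (simp add: sum.cartesian_product D(2) swap)
qed

text \<open>Up to sign, the 2 by 2 minor of the sine transform with rows \<open>x, x'\<close> and columns \<open>y, y'\<close>.\<close>

definition minor :: "nat \<Rightarrow> nat \<times> nat \<Rightarrow> nat \<times> nat \<Rightarrow> real" where
  "minor K = (\<lambda>(x, x') (y, y'). sn K x y' * sn K x' y - sn K x y * sn K x' y')"

text \<open>The Cauchy--Binet formula for 2 by 2 minors: the exterior square of an orthogonal
  matrix is orthogonal. Symmetrization turns the sum over the alcove into a product of single sums,
  which the orthogonality of the sines evaluates. The cross terms vanish because both index pairs
  are strictly decreasing.\<close>

lemma minor_orthogonal:
  assumes "p \<in> alcove K" "q \<in> alcove K"
  shows "(\<Sum>r\<in>alcove K. minor K r p * minor K r q) = (if p = q then (real K / 2)\<^sup>2 else 0)"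
proof -
  obtain a a' b b' where p: "p = (a, a')" and q: "q = (b, b')"
    by fastforce
  define T where "T u v = (\<Sum>j=1..<K. sn K j u * sn K j v)" for u v
  have T: "T u v = (if u = v then real K / 2 else 0)" if "u \<in> {a, a', b, b'}" "v \<in> {a, a', b, b'}" for u v
    unfolding T_def by (rule sn_orthogonal) (use assms that in \<open>auto simp: p q alcove_def\<close>)
  have "2 * (\<Sum>r\<in>alcove K. minor K r p * minor K r q) =
      2 * (\<Sum>(x, y)\<in>alcove K. minor K (x, y) p * minor K (x, y) q)"
    by (simp add: case_prod_unfold)
  also have "\<dots> = (\<Sum>x=1..<K. \<Sum>y=1..<K. minor K (x, y) p * minor K (x, y) q)"
    by (rule sum_alcove) (auto simp: minor_def p q algebra_simps)
  also have "\<dots> = (\<Sum>x=1..<K. \<Sum>y=1..<K.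
      (sn K x a' * sn K x b') * (sn K y a * sn K y b) + (sn K x a * sn K x b) * (sn K y a' * sn K y b')
      - (sn K x a' * sn K x b) * (sn K y a * sn K y b') - (sn K x a * sn K x b') * (sn K y a' * sn K y b))"
    by (intro sum.cong refl) (simp add: minor_def p q algebra_simps)
  also have "\<dots> = T a' b' * T a b + T a b * T a' b' - T a' b * T a b' - T a b' * T a' b"
    unfolding T_def sum_product sum.distrib sum_subtractf by simp
  also have "\<dots> = (if p = q then 2 * (real K / 2)\<^sup>2 else 0)"
    using assms by (auto simp: T p q alcove_def power2_eq_square)
  finally show ?thesis
    by (simp split: if_splits)
qed

definition weight_of :: "nat \<times> nat \<Rightarrow> weight" where
  "weight_of = (\<lambda>(x, y). (int x - int y - 1, int y - 1))"

lemma bij_betw_weight_of: "bij_betw weight_of (alcove (k + 3)) (P_plus k)"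
  by (rule bij_betw_byWitness[where f' = "\<lambda>(l, m). (nat (l + m + 2), nat (m + 1))"])
     (auto simp: weight_of_def alcove_def P_plus_def)

text \<open>In Dynkin coordinates the four cosines have the arguments \<open>L * M \<plusminus> l * m\<close> and
  \<open>L * m \<mp> l * M\<close>, where \<open>L = x + y\<close>, \<open>l = x - y\<close>, and \<open>M\<close>, \<open>m\<close> come likewise from the second weight. Rotation by 45 degrees
  to \<open>x, y\<close> makes them sums and differences of products of single coordinates, so they pair up to
  products of sines.\<close>

lemma S_mat_weight_of:
  "S_mat k (weight_of p) (weight_of q) = 2 / real (k + 3) * minor (k + 3) p q"
proof -
  obtain a a' b b' where p: "p = (a, a')" and q: "q = (b, b')"
    by fastforce
  define t where "t = pi / real (k + 3)"
  have xi: "pi / (2 * (real k + 3)) = t / 2"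
    by (simp add: t_def field_simps)
  have sn: "sn (k + 3) u v = sin (t * (real u * real v))" for u v
    by (simp add: sn_def t_def)
  have "S_mat k (weight_of p) (weight_of q) = 1 / real (k + 3) *
     (cos (t * (real a * real b) + t * (real a' * real b')) - cos (t * (real a * real b') + t * (real a' * real b))
     + cos (t * (real a' * real b) - t * (real a * real b')) - cos (t * (real a * real b) - t * (real a' * real b')))"
    unfolding S_mat_def Let_def xi p q weight_of_def by (simp add: algebra_simps)
  also have "\<dots> = 2 / real (k + 3) * minor (k + 3) p q"
    unfolding minor_def p q sn cos_add cos_diff by (simp add: algebra_simps)
  finally show ?thesis .
qed

lemma S_mat_orthogonal_columns:
  assumes "l \<in> P_plus k" "m \<in> P_plus k"
  shows "(\<Sum>s\<in>P_plus k. S_mat k s l * S_mat k s m) = (if l = m then 1 else 0)"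
proof -
  obtain p q where pq: "p \<in> alcove (k + 3)" "q \<in> alcove (k + 3)" "l = weight_of p" "m = weight_of q"
    using assms bij_betw_imp_surj_on[OF bij_betw_weight_of[of k]] by blast
  have "(\<Sum>s\<in>P_plus k. S_mat k s l * S_mat k s m) =
      (\<Sum>r\<in>alcove (k + 3). S_mat k (weight_of r) l * S_mat k (weight_of r) m)"
    by (rule sum.reindex_bij_betw[OF bij_betw_weight_of, symmetric])
  also have "\<dots> = (2 / real (k + 3))\<^sup>2 * (\<Sum>r\<in>alcove (k + 3). minor (k + 3) r p * minor (k + 3) r q)"
    unfolding pq S_mat_weight_of sum_distrib_left
    by (intro sum.cong refl) (simp add: power2_eq_square algebra_simps)
  also have "\<dots> = (if p = q then 1 else 0)"
    unfolding minor_orthogonal[OF pq(1,2)] by (simp add: power2_eq_square)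
  also have "p = q \<longleftrightarrow> l = m"
    using bij_betw_weight_of[of k] pq by (auto simp: bij_betw_def dest: inj_onD)
  finally show ?thesis .
qed

lemma S_mat_commute: "S_mat k l m = S_mat k m l"
proof -
  define g :: "real \<Rightarrow> real \<Rightarrow> real \<Rightarrow> real \<Rightarrow> real \<Rightarrow> real" where
    "g x L l M m = cos (x * (L * M + l * m)) - cos (x * (L * M - l * m))
      + cos (x * (L * m - l * M)) - cos (x * (L * m + l * M))" for x L l M m
  have "cos (x * (L * m - l * M)) = cos (x * (M * l - m * L))" for x L l M m :: real
    by (subst cos_minus[symmetric]) (simp add: algebra_simps)
  then have "g x L l M m = g x M m L l" for x L l M m
    unfolding g_def by (simp add: mult.commute add.commute)
  then show ?thesis
    unfolding S_mat_def Let_def g_def[symmetric] by simp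
qed

section \<open>Moments as sums over the spectrum\<close>

lemma finite_P_plus [simp]: "finite (P_plus k)"
  using bij_betw_finite[OF bij_betw_weight_of[of k]] by simp

lemma S_mat_orthogonal_rows:
  assumes "l \<in> P_plus k" "m \<in> P_plus k"
  shows "(\<Sum>s\<in>P_plus k. S_mat k l s * S_mat k m s) = (if l = m then 1 else 0)"
  using S_mat_orthogonal_columns[OF assms] by (simp only: S_mat_commute[of k l] S_mat_commute[of k m])

text \<open>The rows of the modular matrix are eigenvectors of every fusion matrix (the Verlinde
  formula read backwards). The hypothesis speaks about \<open>f\<close> on the vertices only, because
  orthogonality yields the spectral expansion of the star vector only there.\<close>

lemma adj_op_eigen:
  assumes "\<And>v. v \<in> P_plus k \<Longrightarrow> f v = (\<Sum>s\<in>P_plus k. complex_of_real (g s * S_mat k s v))"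
  shows "adj_op (A_graph k r) f v =
    (\<Sum>s\<in>P_plus k. complex_of_real (S_mat k s r / S_mat k s vac * g s * S_mat k s v))"
proof -
  define e where "e s = S_mat k s r / S_mat k s vac" for s
  have "adj_op (A_graph k r) f v = complex_of_real
      (\<Sum>w\<in>P_plus k. (\<Sum>s\<in>P_plus k. e s * S_mat k s v * S_mat k s w) * (\<Sum>t\<in>P_plus k. g t * S_mat k t w))"
    by (simp add: adj_op_def A_graph_def fusion_def assms e_def)
  also have "(\<Sum>w\<in>P_plus k. (\<Sum>s\<in>P_plus k. e s * S_mat k s v * S_mat k s w) * (\<Sum>t\<in>P_plus k. g t * S_mat k t w))
      = (\<Sum>w\<in>P_plus k. \<Sum>s\<in>P_plus k. \<Sum>t\<in>P_plus k. e s * S_mat k s v * g t * (S_mat k s w * S_mat k t w))"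
    unfolding sum_product by (intro sum.cong refl) (simp only: mult_ac)
  also have "\<dots> = (\<Sum>s\<in>P_plus k. \<Sum>t\<in>P_plus k. \<Sum>w\<in>P_plus k. e s * S_mat k s v * g t * (S_mat k s w * S_mat k t w))"
    by (rule trans[OF sum.swap sum.cong[OF refl sum.swap]])
  also have "\<dots> = (\<Sum>s\<in>P_plus k. \<Sum>t\<in>P_plus k. e s * S_mat k s v * g t * (if s = t then 1 else 0))"
    by (intro sum.cong refl) (simp only: sum_distrib_left[symmetric] S_mat_orthogonal_rows)
  also have "\<dots> = (\<Sum>s\<in>P_plus k. e s * g s * S_mat k s v)"
    by (intro sum.cong refl) (simp add: if_distrib sum.delta cong: if_cong)
  finally show ?thesis
    by (simp add: e_def)
qed

lemma adj_op_funpow_eigen: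
  assumes "\<And>v. v \<in> P_plus k \<Longrightarrow> f v = (\<Sum>s\<in>P_plus k. complex_of_real (g s * S_mat k s v))"
    and "v \<in> P_plus k"
  shows "(adj_op (A_graph k r) ^^ n) f v =
    (\<Sum>s\<in>P_plus k. complex_of_real ((S_mat k s r / S_mat k s vac) ^ n * g s * S_mat k s v))"
  using assms(2)
proof (induction n arbitrary: v)
  case 0
  then show ?case
    by (simp add: assms(1))
next
  case (Suc n)
  show ?case
    unfolding funpow.simps o_def
    by (subst adj_op_eigen[OF Suc.IH]) (simp_all add: mult.assoc)
qed

lemma vac_in_P_plus [simp]: "vac \<in> P_plus k"
  by (simp add: vac_def P_plus_def)

lemma joint_moment_spectral:
  "joint_moment (A_graph k r) (A_graph k r') m n = complex_of_real
     (\<Sum>s\<in>P_plus k. (S_mat k s vac)\<^sup>2 *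
        ((S_mat k s r / S_mat k s vac) ^ m * (S_mat k s r' / S_mat k s vac) ^ n))"
proof -
  define G where "G = A_graph k r"
  define f where "f = (adj_op G ^^ m) ((adj_op (A_graph k r') ^^ n) (star_vec G))"
  have star: "star_vec G v = (\<Sum>s\<in>P_plus k. complex_of_real (S_mat k s vac * S_mat k s v))"
    if "v \<in> P_plus k" for v
    unfolding of_real_sum[symmetric] S_mat_orthogonal_columns[OF vac_in_P_plus that]
    by (simp add: star_vec_def G_def A_graph_def)
  have "f vac = (\<Sum>s\<in>P_plus k. complex_of_real ((S_mat k s r / S_mat k s vac) ^ m *
      ((S_mat k s r' / S_mat k s vac) ^ n * S_mat k s vac) * S_mat k s vac))"
    unfolding f_def G_def[symmetric]
    by (subst G_def, rule adj_op_funpow_eigen[OF adj_op_funpow_eigen[OF star]]) auto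
  moreover have "joint_moment G (A_graph k r') m n = (\<Sum>v\<in>P_plus k. if v = vac then f v else 0)"
    unfolding joint_moment_def f_def
    by (intro sum.cong) (auto simp: G_def A_graph_def star_vec_def)
  ultimately show ?thesis
    by (simp add: G_def power2_eq_square algebra_simps)
qed

definition angle :: "nat \<Rightarrow> nat \<Rightarrow> real" where
  "angle K j = pi * real j / real K"

lemma weight_of_vac: "vac = weight_of (2, 1)"
  and weight_of_rho_x: "rho_x = weight_of (3, 1)"
  and weight_of_rho_y: "rho_y = weight_of (3, 2)"
  by (simp_all add: vac_def rho_x_def rho_y_def weight_of_def)

lemma sin_triple: "sin (3 * x :: real) = sin x * (4 * (cos x)\<^sup>2 - 1)"
proof -
  have "sin (3 * x) = sin (2 * x + x)"
    by simp
  also have "\<dots> = sin x * (4 * (cos x)\<^sup>2 - 1)"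
    unfolding sin_add sin_double cos_double_cos by (simp add: algebra_simps power2_eq_square)
  finally show ?thesis .
qed

lemma sn_multiple:
  "sn K j 1 = sin (angle K j)" "sn K j 2 = sin (2 * angle K j)" "sn K j 3 = sin (3 * angle K j)"
  by (simp_all add: sn_def angle_def mult_ac)

lemma minor_vac:
  "minor K (x, y) (2, 1) =
    2 * sin (angle K x) * sin (angle K y) * (cos (angle K y) - cos (angle K x))"
  unfolding minor_def prod.case sn_multiple sin_double by (simp add: algebra_simps)

text \<open>At the weights of the two fundamental representations the minors are multiples of the
  minor at the vacuum; the factor is the character at the corresponding torus point. This is the
  Weyl character formula for the two representations.\<close>

lemma minor_rho_x:
  "minor K (x, y) (3, 1) = minor K (x, y) (2, 1) * (2 * cos (angle K x) + 2 * cos (angle K y))"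
  unfolding minor_vac unfolding minor_def prod.case sn_multiple sin_triple
  by (simp add: algebra_simps power2_eq_square)

lemma minor_rho_y:
  "minor K (x, y) (3, 2) = minor K (x, y) (2, 1) * (1 + 4 * cos (angle K x) * cos (angle K y))"
  unfolding minor_vac unfolding minor_def prod.case sn_multiple sin_triple sin_double
  by (simp add: algebra_simps power2_eq_square)

text \<open>On the alcove both angles lie strictly between \<open>0\<close> and \<open>pi\<close> and are distinct, so no
  root hyperplane is met.\<close>

lemma minor_vac_nonzero:
  assumes "(x, y) \<in> alcove K"
  shows "minor K (x, y) (2, 1) \<noteq> 0"
proof -
  have "0 < angle K y" "angle K y < angle K x" "angle K x < pi"
    using assms by (auto simp: alcove_def angle_def field_simps)
  then have "sin (angle K x) > 0" "sin (angle K y) > 0" "cos (angle K x) < cos (angle K y)"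
    by (auto intro!: sin_gt_zero cos_monotone_0_pi)
  then show ?thesis
    unfolding minor_vac by simp
qed

text \<open>The squared vacuum entry is a multiple of the squared Weyl denominator, which is invariant
  under swap and sign changes and vanishes on all mirrors. Hence the sum over the alcove can be
  unfolded to the sum over all pairs of residues modulo \<open>2 * K\<close>: eight copies of the alcove.\<close>

lemma joint_moment_sum:
  fixes k m n :: nat
  defines "K \<equiv> k + 3"
  shows "joint_moment (A_graph k rho_x) (A_graph k rho_y) m n = complex_of_real
     (2 / (real K)\<^sup>2 * (\<Sum>x<2 * K. \<Sum>y<2 * K.
       (sin (angle K x) * sin (angle K y) * (cos (angle K x) - cos (angle K y)))\<^sup>2 *
       ((2 * cos (angle K x) + 2 * cos (angle K y)) ^ m * (1 + 4 * cos (angle K x) * cos (angle K y)) ^ n)))"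
proof -
  define F where "F x y =
    (sin (angle K x) * sin (angle K y) * (cos (angle K x) - cos (angle K y)))\<^sup>2 *
    ((2 * cos (angle K x) + 2 * cos (angle K y)) ^ m * (1 + 4 * cos (angle K x) * cos (angle K y)) ^ n)" for x y
  have K: "K > 0"
    by (simp add: K_def)
  have "(\<Sum>s\<in>P_plus k. (S_mat k s vac)\<^sup>2 *
        ((S_mat k s rho_x / S_mat k s vac) ^ m * (S_mat k s rho_y / S_mat k s vac) ^ n)) =
      (\<Sum>r\<in>alcove K. (S_mat k (weight_of r) vac)\<^sup>2 *
        ((S_mat k (weight_of r) rho_x / S_mat k (weight_of r) vac) ^ m *
         (S_mat k (weight_of r) rho_y / S_mat k (weight_of r) vac) ^ n))"
    unfolding K_def by (rule sum.reindex_bij_betw[OF bij_betw_weight_of, symmetric])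
  also have "\<dots> = (\<Sum>(x, y)\<in>alcove K. 16 / (real K)\<^sup>2 * F x y)"
  proof (intro sum.cong refl, clarify)
    fix x y
    assume "(x, y) \<in> alcove K"
    note nz = minor_vac_nonzero[OF this]
    have "(2 / real K * minor K (x, y) (2, 1))\<^sup>2 =
        16 / (real K)\<^sup>2 * (sin (angle K x) * sin (angle K y) * (cos (angle K x) - cos (angle K y)))\<^sup>2"
      unfolding minor_vac by (simp add: field_simps power2_eq_square)
    moreover have "2 / real K \<noteq> 0"
      using K by simp
    ultimately show "(S_mat k (weight_of (x, y)) vac)\<^sup>2 *
        ((S_mat k (weight_of (x, y)) rho_x / S_mat k (weight_of (x, y)) vac) ^ m *
         (S_mat k (weight_of (x, y)) rho_y / S_mat k (weight_of (x, y)) vac) ^ n) = 16 / (real K)\<^sup>2 * F x y"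
      unfolding weight_of_vac weight_of_rho_x weight_of_rho_y S_mat_weight_of K_def[symmetric]
        minor_rho_x minor_rho_y F_def
      using nz by simp
  qed
  also have "\<dots> = 8 / (real K)\<^sup>2 * (2 * (\<Sum>(x, y)\<in>alcove K. F x y))"
    by (simp add: sum_distrib_left case_prod_unfold)
  also have "2 * (\<Sum>(x, y)\<in>alcove K. F x y) = (\<Sum>x=1..<K. \<Sum>y=1..<K. F x y)"
    by (rule sum_alcove) (simp_all add: F_def power2_eq_square algebra_simps)
  also have "8 / (real K)\<^sup>2 * \<dots> = 2 / (real K)\<^sup>2 * (\<Sum>x<2 * K. \<Sum>y<2 * K. F x y)"
  proof -
    have refl: "sin (angle K (2 * K - j)) = - sin (angle K j)" "cos (angle K (2 * K - j)) = cos (angle K j)"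
      if "j < K" for j
    proof -
      have "angle K (2 * K - j) = 2 * pi - angle K j"
        using that K by (simp add: angle_def of_nat_diff field_simps)
      then show "sin (angle K (2 * K - j)) = - sin (angle K j)" "cos (angle K (2 * K - j)) = cos (angle K j)"
        by (simp_all add: sin_diff cos_diff)
    qed
    have van: "sin (angle K 0) = 0" "sin (angle K K) = 0"
      using K by (simp_all add: angle_def)
    have inner: "(\<Sum>y<2 * K. F x y) = 2 * (\<Sum>y=1..<K. F x y)" for x
      by (rule sum_fold_even) (simp_all add: F_def refl van)
    have "(\<Sum>x<2 * K. \<Sum>y<2 * K. F x y) = 2 * (\<Sum>x=1..<K. \<Sum>y<2 * K. F x y)"
      by (rule sum_fold_even) (simp_all add: F_def refl van)
    then show ?thesis
      by (simp add: inner sum_distrib_left)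
  qed
  finally show ?thesis
    unfolding joint_moment_spectral F_def by (rule arg_cong)
qed

section \<open>Characters and Jacobian on the torus\<close>

abbreviation torus :: "(complex \<times> complex) set" where
  "torus \<equiv> sphere 0 1 \<times> sphere 0 1"

definition re_chi :: "complex \<times> complex \<Rightarrow> real \<times> real" where
  "re_chi = (\<lambda>(a, b). (2 * Re a + 2 * Re b, 1 + 4 * Re a * Re b))"

lemma inverse_on_circle:
  fixes z :: complex
  assumes "norm z = 1"
  shows "inverse z = cnj z"
  using assms by (simp add: inverse_complex_def complex_eq_iff cmod_power2[symmetric])

lemma chi_on_torus:
  assumes "w \<in> torus"
  shows "chi_x w = of_real (fst (re_chi w))" "chi_y w = of_real (snd (re_chi w))"
  using assms
  by (auto simp: chi_x_def chi_y_def re_chi_def inverse_on_circle complex_eq_iff algebra_simps)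

text \<open>The Jacobian is, up to a constant, the Weyl denominator, in a form whose zeros and symmetries
  are visible.\<close>

lemma J_xy_on_torus:
  assumes "w \<in> torus"
  shows "J_xy w = 32 * pi\<^sup>2 * Im (fst w) * Im (snd w) * (Re (fst w) - Re (snd w))"
proof -
  define a b where "a = Arg (fst w)" and "b = Arg (snd w)"
  have "cis (Arg z) = z" if "norm z = 1" for z
    using that cis_Arg[of z] by (cases "z = 0") (auto simp: sgn_eq)
  then have w: "w = (cis a, cis b)"
    using assms by (cases w) (auto simp: a_def b_def)
  have "J_xy w = J_theta (a / (2 * pi)) (b / (2 * pi))"
    using J_xy_cis[of "a / (2 * pi)" "b / (2 * pi)"] by (simp add: w)
  also have "\<dots> = 8 * pi\<^sup>2 * (cos (a + 2 * b) + cos (2 * a - b) - cos (2 * a + b) - cos (a - 2 * b))"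
    by (simp add: J_theta_def distrib_left right_diff_distrib)
  also have "\<dots> = 32 * pi\<^sup>2 * sin a * sin b * (cos a - cos b)"
    unfolding cos_add cos_diff sin_double by (simp add: algebra_simps)
  finally show ?thesis
    by (simp add: w)
qed

lemma space_circle_borel [simp]: "space circle_borel = sphere 0 1"
  by (simp add: circle_borel_def space_restrict_space)

lemma space_torus_borel [simp]: "space torus_borel = torus"
  by (simp add: torus_borel_def space_pair_measure)

lemma circle_borel_coe: "(\<lambda>z. z) \<in> borel_measurable circle_borel"
  unfolding circle_borel_def by (rule measurable_restrict_space1) simp

lemma borel_measurable_torus [measurable]:
  "fst \<in> borel_measurable torus_borel" "snd \<in> borel_measurable torus_borel"
  unfolding torus_borel_def
  by (rule measurable_compose[OF measurable_fst circle_borel_coe]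
      measurable_compose[OF measurable_snd circle_borel_coe])+

lemma borel_measurable_re_chi [measurable]:
  "(\<lambda>w. fst (re_chi w)) \<in> borel_measurable torus_borel"
  "(\<lambda>w. snd (re_chi w)) \<in> borel_measurable torus_borel"
  unfolding re_chi_def case_prod_unfold by simp_all

lemma borel_measurable_J_xy [measurable]: "J_xy \<in> borel_measurable torus_borel"
proof -
  have "J_xy \<in> borel_measurable torus_borel \<longleftrightarrow>
      (\<lambda>w. 32 * pi\<^sup>2 * Im (fst w) * Im (snd w) * (Re (fst w) - Re (snd w))) \<in> borel_measurable torus_borel"
    by (rule measurable_cong) (use J_xy_on_torus in simp)
  then show ?thesis
    by simp
qed

lemma singleton_in_sets_torus: "w \<in> torus \<Longrightarrow> {w} \<in> sets torus_borel"
proof (cases w)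
  case (Pair a b)
  assume "w \<in> torus"
  then have "{a} \<in> sets circle_borel" "{b} \<in> sets circle_borel"
    by (auto simp: Pair circle_borel_def sets_restrict_space)
  then have "{a} \<times> {b} \<in> sets torus_borel"
    unfolding torus_borel_def by (rule pair_measureI)
  then show ?thesis
    by (simp add: Pair)
qed

lemma finite_in_sets_torus:
  assumes "finite A" "A \<subseteq> torus"
  shows "A \<in> sets torus_borel"
  by (rule sets.countable) (use assms singleton_in_sets_torus countable_finite in blast)+

section \<open>Orbits of the Weyl group\<close>

abbreviation swap_map :: "complex \<times> complex \<Rightarrow> complex \<times> complex" where
  "swap_map \<equiv> \<lambda>(w1, w2). (w2, w1)"

abbreviation rot_map :: "complex \<times> complex \<Rightarrow> complex \<times> complex" where
  "rot_map \<equiv> \<lambda>(w1, w2). (w2, inverse w1)"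

lemma measurable_swap_map: "swap_map \<in> measurable torus_borel torus_borel"
  unfolding torus_borel_def by (rule measurable_pair_swap')

lemma measurable_rot_map: "rot_map \<in> measurable torus_borel torus_borel"
proof -
  have "inverse \<in> measurable circle_borel circle_borel"
    unfolding circle_borel_def
    by (rule measurable_restrict_space2)
       (auto simp: norm_inverse intro!: measurable_compose[OF circle_borel_coe[unfolded circle_borel_def]] 
          borel_measurable_inverse)
  then show ?thesis
    unfolding torus_borel_def case_prod_unfold
    by (intro measurable_Pair measurable_snd measurable_compose[OF measurable_fst])
qed

text \<open>Pushing forward along a composite is pushing forward twice, so invariance under the two
  generators passes to all products of them.\<close>

lemma D8_invariant_iff:
  assumes "sets M = sets torus_borel"
  shows "D8_invariant M \<longleftrightarrow> distr M M swap_map = M \<and> distr M M rot_map = M"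
proof
  assume *: "D8_invariant M"
  have "swap_map \<circ> id \<in> weyl_D8" "rot_map \<circ> id \<in> weyl_D8"
    by (intro weyl_D8.intros)+
  with * show "distr M M swap_map = M \<and> distr M M rot_map = M"
    unfolding D8_invariant_def by fastforce
next
  assume inv: "distr M M swap_map = M \<and> distr M M rot_map = M"
  have meas: "swap_map \<in> measurable M M" "rot_map \<in> measurable M M"
    using measurable_swap_map measurable_rot_map
    by (simp_all add: measurable_cong_sets[OF assms assms])
  have "g \<in> measurable M M \<and> distr M M g = M" if "g \<in> weyl_D8" for g
    using that
  proof induction
    case one
    show ?case
      using distr_id[of M] by (simp add: id_def)
  next
    case (swap g)
    then have "distr M M (swap_map \<circ> g) = distr (distr M M g) M swap_map"
      using swap.IH by (intro distr_distr[OF meas(1), symmetric]) blast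
    then show ?case
      using swap.IH inv measurable_comp[OF conjunct1[OF swap.IH] meas(1)] by metis
  next
    case (rot g)
    then have "distr M M (rot_map \<circ> g) = distr (distr M M g) M rot_map"
      using rot.IH by (intro distr_distr[OF meas(2), symmetric]) blast
    then show ?case
      using rot.IH inv measurable_comp[OF conjunct1[OF rot.IH] meas(2)] by metis
  qed
  then show "D8_invariant M"
    unfolding D8_invariant_def by blast
qed

lemma measure_singleton_invariant:
  assumes "sets M = sets torus_borel" "g \<in> measurable M M" "distr M M g = M" "inj g" "w \<in> torus"
  shows "measure M {g w} = measure M {w}"
proof -
  have sp: "space M = torus"
    using sets_eq_imp_space_eq[OF assms(1)] by simp
  then have gw: "g w \<in> torus"
    using measurable_space[OF assms(2)] assms(5) by simp
  have "measure M {g w} = measure (distr M M g) {g w}"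
    by (simp add: assms(3))
  also have "\<dots> = measure M (g -` {g w} \<inter> space M)"
    using assms(1,2) singleton_in_sets_torus[OF gw] by (intro measure_distr) auto
  also have "g -` {g w} \<inter> space M = {w}"
    using assms(4,5) sp by (auto dest: injD)
  finally show ?thesis .
qed

definition orbit :: "complex \<times> complex \<Rightarrow> (complex \<times> complex) set" where
  "orbit = (\<lambda>(a, b). {a, inverse a} \<times> {b, inverse b} \<union> {b, inverse b} \<times> {a, inverse a})"

lemma orbit_facts:
  "finite (orbit w)" "w \<in> orbit w" "w \<in> torus \<Longrightarrow> orbit w \<subseteq> torus"
  by (auto simp: orbit_def norm_inverse split: prod.splits)

text \<open>The pair of characters separates the orbits: it determines the sum and the product of
  \<open>Re a\<close> and \<open>Re b\<close>, hence these two numbers up to order, and a point of the circle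
  is determined by its real part up to inversion.\<close>

lemma orbit_eq_fibre:
  assumes "w \<in> torus"
  shows "orbit w = {v \<in> torus. re_chi v = re_chi w}"
proof (intro equalityI subsetI)
  fix v
  assume "v \<in> orbit w"
  moreover have "v \<in> torus"
    using calculation orbit_facts(3)[OF assms] by blast
  ultimately show "v \<in> {v \<in> torus. re_chi v = re_chi w}"
    using assms by (auto simp: orbit_def re_chi_def inverse_on_circle)
next
  have circle: "u = z \<or> u = inverse z" if "norm u = 1" "norm z = 1" "Re u = Re z" for u z :: complex
  proof -
    have "(Im u)\<^sup>2 = (Im z)\<^sup>2"
      using that cmod_power2[of u] cmod_power2[of z] by simp
    then have "Im u = Im z \<or> Im u = - Im z"
      by (simp add: power2_eq_iff)
    then show ?thesis
      using that by (auto simp: inverse_on_circle complex_eq_iff)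
  qed
  fix v
  assume v: "v \<in> {v \<in> torus. re_chi v = re_chi w}"
  obtain a b c d where ab: "v = (a, b)" and cd: "w = (c, d)"
    by fastforce
  have n: "norm a = 1" "norm b = 1" "norm c = 1" "norm d = 1"
    using v assms by (auto simp: ab cd)
  have s: "Re a + Re b = Re c + Re d" and p: "Re a * Re b = Re c * Re d"
    using v by (auto simp: ab cd re_chi_def)
  \<comment> \<open>\<open>Re a\<close> is a root of the quadratic polynomial with the roots \<open>Re c\<close> and \<open>Re d\<close>.\<close>
  have "(Re a - Re c) * (Re a - Re d) = 0"
    using s p by algebra
  then have "Re a = Re c \<and> Re b = Re d \<or> Re a = Re d \<and> Re b = Re c"
    using s by auto
  then have "a \<in> {c, inverse c} \<and> b \<in> {d, inverse d} \<or> a \<in> {d, inverse d} \<and> b \<in> {c, inverse c}"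
    using circle[OF n(1) n(3)] circle[OF n(2) n(4)] circle[OF n(1) n(4)] circle[OF n(2) n(3)] by blast
  then show "v \<in> orbit w"
    unfolding ab cd orbit_def by blast
qed

lemma measure_orbit:
  assumes "finite_measure M" "sets M = sets torus_borel" "D8_invariant M" "w \<in> torus"
  shows "measure M (orbit w) = real (card (orbit w)) * measure M {w}"
proof -
  have meas: "swap_map \<in> measurable M M" "rot_map \<in> measurable M M"
    using measurable_swap_map measurable_rot_map
    by (simp_all add: measurable_cong_sets[OF assms(2) assms(2)])
  have inv: "distr M M swap_map = M" "distr M M rot_map = M"
    using assms(3) D8_invariant_iff[OF assms(2)] by auto
  have swap: "measure M {(b, a)} = measure M {(a, b)}" if "norm a = 1" "norm b = 1" for a b
    using measure_singleton_invariant[OF assms(2) meas(1) inv(1), of "(a, b)"] that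
    by (simp add: inj_def)
  have rot: "measure M {(b, inverse a)} = measure M {(a, b)}" if "norm a = 1" "norm b = 1" for a b
    using measure_singleton_invariant[OF assms(2) meas(2) inv(2), of "(a, b)"] that
    by (simp add: inj_def)
  have inv2: "measure M {(a, inverse b)} = measure M {(a, b)}" if "norm a = 1" "norm b = 1" for a b
    using swap[OF that] rot[of b a] that by simp
  have inv1: "measure M {(inverse a, b)} = measure M {(a, b)}" if "norm a = 1" "norm b = 1" for a b
    using swap[of b "inverse a"] rot[OF that] that by (simp add: norm_inverse)
  have const: "measure M {v} = measure M {w}" if "v \<in> orbit w" for v
    using that assms(4) by (auto simp: orbit_def norm_inverse swap inv1 inv2)
  have "measure M (orbit w) = (\<Sum>v\<in>orbit w. measure M {v})"
    using orbit_facts[of w] assms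
    by (intro finite_measure.finite_measure_eq_sum_singleton) (auto intro!: singleton_in_sets_torus)
  then show ?thesis
    by (simp add: const)
qed

section \<open>Invariant measures with finite support are determined by their moments\<close>

lemma integrable_continuous_on_torus:
  fixes f :: "complex \<times> complex \<Rightarrow> real"
  assumes "finite_measure M" "sets M = sets torus_borel"
    and "continuous_on torus f" "f \<in> borel_measurable torus_borel"
  shows "integrable M f"
proof -
  have "compact (f ` torus)"
    by (intro compact_continuous_image assms(3) compact_Times) simp_all
  then obtain B where B: "\<And>w. w \<in> torus \<Longrightarrow> norm (f w) \<le> B"
    using compact_imp_bounded bounded_iff by (metis image_eqI)
  have "space M = torus"
    using sets_eq_imp_space_eq[OF assms(2)] by simp
  moreover have "f \<in> borel_measurable M"
    using assms(4) by (simp add: measurable_cong_sets[OF assms(2) refl])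
  ultimately show ?thesis
    using B by (intro finite_measure.integrable_const_bound[OF assms(1), of f B]) auto
qed

lemma integral_moment:
  assumes "sets M = sets torus_borel"
  shows "(\<integral>w. chi_x w ^ m * chi_y w ^ n \<partial>M) =
    of_real (\<integral>w. fst (re_chi w) ^ m * snd (re_chi w) ^ n \<partial>M)"
proof -
  have "space M = torus"
    using sets_eq_imp_space_eq[OF assms] by simp
  then have "(\<integral>w. chi_x w ^ m * chi_y w ^ n \<partial>M) =
      (\<integral>w. complex_of_real (fst (re_chi w) ^ m * snd (re_chi w) ^ n) \<partial>M)"
    by (intro Bochner_Integration.integral_cong) (simp_all add: chi_on_torus)
  also have "\<dots> = of_real (\<integral>w. fst (re_chi w) ^ m * snd (re_chi w) ^ n \<partial>M)"
    by (rule integral_complex_of_real)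
  finally show ?thesis .
qed

text \<open>For finite \<open>P\<close>, a nonnegative polynomial in two variables whose zero set is \<open>P\<close>. Inserted into the characters it
  plays the role of a test function that the moments can integrate.\<close>

definition sq_dist_prod :: "(real \<times> real) set \<Rightarrow> real \<times> real \<Rightarrow> real" where
  "sq_dist_prod P u = (\<Prod>p\<in>P. (fst u - fst p)\<^sup>2 + (snd u - snd p)\<^sup>2)"

lemma sq_dist_prod_nonneg: "sq_dist_prod P u \<ge> 0"
  unfolding sq_dist_prod_def by (intro prod_nonneg) simp

lemma sq_dist_prod_eq_0_iff: "finite P \<Longrightarrow> sq_dist_prod P u = 0 \<longleftrightarrow> u \<in> P"
  by (auto simp: sq_dist_prod_def prod_zero_iff prod_eq_iff)

lemma integrable_sq_dist_prod:
  assumes "finite_measure M" "sets M = sets torus_borel"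
  shows "integrable M (\<lambda>w. sq_dist_prod P (re_chi w) * fst (re_chi w) ^ m * snd (re_chi w) ^ n)"
  by (rule integrable_continuous_on_torus[OF assms])
     (auto simp: sq_dist_prod_def re_chi_def case_prod_unfold intro!: continuous_intros)

text \<open>Carrying arbitrary powers of the characters along makes the statement inductive in \<open>P\<close>: a new
  factor is a quadratic polynomial in the characters and only shifts the exponents.\<close>

lemma integral_sq_dist_prod_eq:
  assumes "finite_measure M" "sets M = sets torus_borel"
    and "finite_measure M'" "sets M' = sets torus_borel"
    and "\<And>m n. (\<integral>w. fst (re_chi w) ^ m * snd (re_chi w) ^ n \<partial>M) =
      (\<integral>w. fst (re_chi w) ^ m * snd (re_chi w) ^ n \<partial>M')"
    and "finite P"
  shows "(\<integral>w. sq_dist_prod P (re_chi w) * fst (re_chi w) ^ m * snd (re_chi w) ^ n \<partial>M) =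
    (\<integral>w. sq_dist_prod P (re_chi w) * fst (re_chi w) ^ m * snd (re_chi w) ^ n \<partial>M')"
  using assms(6)
proof (induction P arbitrary: m n)
  case empty
  show ?case
    by (simp add: sq_dist_prod_def assms(5))
next
  case (insert p P)
  define f where "f i j w = sq_dist_prod P (re_chi w) * fst (re_chi w) ^ i * snd (re_chi w) ^ j" for i j w
  have expand: "sq_dist_prod (insert p P) (re_chi w) * fst (re_chi w) ^ m * snd (re_chi w) ^ n =
      f (m + 2) n w - 2 * fst p * f (m + 1) n w + f m (n + 2) w - 2 * snd p * f m (n + 1) w +
      ((fst p)\<^sup>2 + (snd p)\<^sup>2) * f m n w" for w
  proof -
    have step: "sq_dist_prod (insert p P) (re_chi w) =
        ((fst (re_chi w) - fst p)\<^sup>2 + (snd (re_chi w) - snd p)\<^sup>2) * sq_dist_prod P (re_chi w)"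
      using insert.hyps by (simp add: sq_dist_prod_def)
    show ?thesis
      unfolding step f_def by (simp add: power2_eq_square algebra_simps)
  qed
  have I: "integrable M (f i j)" "integrable M' (f i j)" for i j
    unfolding f_def using integrable_sq_dist_prod assms(1-4) by blast+
  have "(\<integral>w. f i j w \<partial>M) = (\<integral>w. f i j w \<partial>M')" for i j
    unfolding f_def by (rule insert.IH)
  then show ?case
    unfolding expand by (simp add: I)
qed

text \<open>With the single value \<open>re_chi v\<close> removed from the zero set, the test polynomial is a
  multiple of the indicator of the fibre through \<open>v\<close> almost everywhere. The fibre is one orbit, on
  which an invariant measure is uniform, so the integral reads off the mass of \<open>v\<close>.\<close>

lemma integral_sq_dist_prod_punctured:
  assumes "finite_measure M" "sets M = sets torus_borel" "D8_invariant M"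
    and "finite P" "AE w in M. re_chi w \<in> P" "v \<in> torus" "re_chi v \<in> P"
  shows "(\<integral>w. sq_dist_prod (P - {re_chi v}) (re_chi w) \<partial>M) =
    sq_dist_prod (P - {re_chi v}) (re_chi v) * real (card (orbit v)) * measure M {v}"
proof -
  let ?L = "sq_dist_prod (P - {re_chi v})"
  have sp: "space M = torus"
    using sets_eq_imp_space_eq[OF assms(2)] by simp
  have orb: "orbit v \<in> sets M"
    using orbit_facts[of v] assms(2,6) finite_in_sets_torus by metis
  have "AE w in M. w \<in> torus"
    using AE_space[of M] by (simp add: sp)
  with assms(5) have "AE w in M. ?L (re_chi w) = ?L (re_chi v) * indicator (orbit v) w"
  proof eventually_elim
    case (elim w)
    show ?case
    proof (cases "re_chi w = re_chi v")
      case True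
      then show ?thesis
        using elim by (simp add: orbit_eq_fibre[OF assms(6)])
    next
      case False
      then show ?thesis
        using elim assms(4) by (simp add: orbit_eq_fibre[OF assms(6)] sq_dist_prod_eq_0_iff)
    qed
  qed
  moreover have "(\<lambda>w. ?L (re_chi w)) \<in> borel_measurable M"
    using borel_measurable_integrable[OF integrable_sq_dist_prod[OF assms(1,2), of _ 0 0]] by simp
  ultimately have "(\<integral>w. ?L (re_chi w) \<partial>M) = (\<integral>w. ?L (re_chi v) * indicator (orbit v) w \<partial>M)"
    using orb by (intro integral_cong_AE) auto
  also have "\<dots> = ?L (re_chi v) * measure M (orbit v)"
    using orb sets.sets_into_space[OF orb] by (simp add: Int_absorb2)
  finally show ?thesis
    by (simp add: measure_orbit[OF assms(1-3,6)])
qed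

text \<open>The polynomial vanishing on the image of \<open>F\<close> has integral zero for \<open>M'\<close>, hence also for \<open>M\<close>;
  being nonnegative, it vanishes almost everywhere. So \<open>M\<close> lives on the finitely many orbits that
  meet \<open>F\<close>, and there the punctured polynomials compare the point masses.\<close>

lemma D8_invariant_measure_determined:
  assumes M: "finite_measure M" "sets M = sets torus_borel" "D8_invariant M"
    and M': "finite_measure M'" "sets M' = sets torus_borel" "D8_invariant M'"
    and moments: "\<And>m n. (\<integral>w. chi_x w ^ m * chi_y w ^ n \<partial>M) = (\<integral>w. chi_x w ^ m * chi_y w ^ n \<partial>M')"
    and F: "finite F" "F \<subseteq> torus" "AE w in M'. w \<in> F"
  shows "M = M'"
proof -
  define P where "P = re_chi ` F"
  have P: "finite P"
    by (simp add: P_def F)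
  have sp: "space M = torus" "space M' = torus"
    using sets_eq_imp_space_eq[OF M(2)] sets_eq_imp_space_eq[OF M'(2)] by simp_all
  have "complex_of_real (\<integral>w. fst (re_chi w) ^ m * snd (re_chi w) ^ n \<partial>M) =
      complex_of_real (\<integral>w. fst (re_chi w) ^ m * snd (re_chi w) ^ n \<partial>M')" for m n
    using moments[of m n] by (simp only: integral_moment M(2) M'(2))
  then have real_moments: "(\<integral>w. fst (re_chi w) ^ m * snd (re_chi w) ^ n \<partial>M) =
      (\<integral>w. fst (re_chi w) ^ m * snd (re_chi w) ^ n \<partial>M')" for m n
    using of_real_eq_iff by blast
  have eq: "(\<integral>w. sq_dist_prod Q (re_chi w) \<partial>M) = (\<integral>w. sq_dist_prod Q (re_chi w) \<partial>M')" if "finite Q" for Q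
    using integral_sq_dist_prod_eq[OF M(1,2) M'(1,2) real_moments that, of 0 0] by simp
  have supp': "AE w in M'. re_chi w \<in> P"
    using F(3) by eventually_elim (simp add: P_def)
  have int: "integrable M (\<lambda>w. sq_dist_prod P (re_chi w))"
    using integrable_sq_dist_prod[OF M(1,2), of P 0 0] by simp
  have "(\<integral>w. sq_dist_prod P (re_chi w) \<partial>M') = 0"
    using supp' by (intro integral_eq_zero_AE) (simp add: sq_dist_prod_eq_0_iff[OF P])
  then have "(\<integral>w. sq_dist_prod P (re_chi w) \<partial>M) = 0"
    by (simp add: eq[OF P])
  then have supp: "AE w in M. re_chi w \<in> P"
    using integral_nonneg_eq_0_iff_AE[OF int] by (simp add: sq_dist_prod_nonneg sq_dist_prod_eq_0_iff[OF P])
  define G where "G = {w \<in> torus. re_chi w \<in> P}"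
  have "G = (\<Union>w\<in>F. orbit w)"
    using F(2) by (auto simp: G_def P_def orbit_eq_fibre subset_iff)
  then have finG: "finite G"
    using F(1) by (simp add: orbit_facts)
  have point: "measure M {v} = measure M' {v}" if "v \<in> G" for v
  proof -
    have v: "v \<in> torus" "re_chi v \<in> P"
      using that by (auto simp: G_def)
    have "sq_dist_prod (P - {re_chi v}) (re_chi v) \<noteq> 0"
      using P by (simp add: sq_dist_prod_eq_0_iff)
    moreover have "card (orbit v) \<noteq> 0"
      using orbit_facts(1,2)[of v] by auto
    ultimately show ?thesis
      using eq[of "P - {re_chi v}"] P
      by (simp add: integral_sq_dist_prod_punctured[OF M P supp v] integral_sq_dist_prod_punctured[OF M' P supp' v])
  qed
  have on_G: "measure N A = (\<Sum>v\<in>A \<inter> G. measure N {v})"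
    if N: "finite_measure N" "sets N = sets torus_borel" "space N = torus" "AE w in N. re_chi w \<in> P"
      and A: "A \<in> sets torus_borel" for N A
  proof -
    have AG: "A \<inter> G \<in> sets N"
      unfolding N(2) using finG by (intro finite_in_sets_torus) (auto simp: G_def)
    have "measure N A = measure N (A \<inter> G)"
    proof (rule finite_measure.finite_measure_eq_AE[OF N(1)])
      show "AE w in N. w \<in> A \<longleftrightarrow> w \<in> A \<inter> G"
        using N(4) AE_space[of N] by eventually_elim (auto simp: G_def N(3))
    qed (use AG A N(2) in auto)
    also have "\<dots> = (\<Sum>v\<in>A \<inter> G. measure N {v})"
      using finG N by (intro finite_measure.finite_measure_eq_sum_singleton)
        (auto simp: G_def intro!: singleton_in_sets_torus)
    finally show ?thesis .
  qed
  show ?thesis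
  proof (rule measure_eqI)
    fix A
    assume "A \<in> sets M"
    then have A: "A \<in> sets torus_borel"
      by (simp add: M(2))
    have "measure M A = measure M' A"
      unfolding on_G[OF M(1,2) sp(1) supp A] on_G[OF M'(1,2) sp(2) supp' A]
      by (intro sum.cong refl point) simp
    then show "emeasure M A = emeasure M' A"
      by (simp add: finite_measure.emeasure_eq_measure M(1) M'(1))
  qed (simp add: M(2) M'(2))
qed

section \<open>The density of the squared Jacobian on the roots of unity\<close>

abbreviation roots :: "nat \<Rightarrow> complex set" where
  "roots N \<equiv> {z. z ^ N = 1}"

lemma roots_facts:
  assumes "N > 0"
  shows "finite (roots N)" "card (roots N) = N" "roots N \<subseteq> sphere 0 1"
proof -
  show "finite (roots N)" "card (roots N) = N"
    using bij_betw_finite[OF Complex.bij_betw_roots_unity[OF assms]] card_roots_unity_eq[OF assms] by auto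
  show "roots N \<subseteq> sphere 0 1"
  proof
    fix z :: complex
    assume "z \<in> roots N"
    then have "norm z ^ N = 1"
      by (simp flip: norm_power)
    then show "z \<in> sphere 0 1"
      using assms power_eq_1_iff[of "norm z" N] by auto
  qed
qed

lemma dirac_roots_pair:
  assumes "N > 0"
  shows "dirac_roots N \<Otimes>\<^sub>M dirac_roots N =
    distr (density (count_space (roots N \<times> roots N)) (\<lambda>_. ennreal (1 / (real N)\<^sup>2))) torus_borel (\<lambda>w. w)"
proof -
  define c where "c = ennreal (1 / real N)"
  let ?C = "count_space (roots N)"
  note R = roots_facts[OF assms]
  have unif: "uniform_count_measure (roots N) = density ?C (\<lambda>_. c)"
    by (simp add: uniform_count_measure_def point_measure_def R(2) c_def)
  have coe: "(\<lambda>z. z) \<in> measurable (density ?C (\<lambda>_. c)) circle_borel"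
    using R(3) by auto
  have fin: "finite_measure (density ?C (\<lambda>_. c))"
    by (rule finite_measureI)
       (simp add: emeasure_density nn_integral_count_space_finite R(1) c_def ennreal_mult_eq_top_iff)
  have "dirac_roots N \<Otimes>\<^sub>M dirac_roots N =
      distr (density ?C (\<lambda>_. c) \<Otimes>\<^sub>M density ?C (\<lambda>_. c)) torus_borel (\<lambda>(x, y). (x, y))"
    unfolding dirac_roots_def unif torus_borel_def
    by (intro pair_measure_distr coe finite_measure.axioms(1) finite_measure.finite_measure_distr[OF fin])
  also have "density ?C (\<lambda>_. c) \<Otimes>\<^sub>M density ?C (\<lambda>_. c) = density (?C \<Otimes>\<^sub>M ?C) (\<lambda>(x, y). c * c)"
    by (intro pair_measure_density finite_measure.axioms(1)[OF fin]
        sigma_finite_measure_count_space_countable countable_finite R(1)) simp_all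
  also have "?C \<Otimes>\<^sub>M ?C = count_space (roots N \<times> roots N)"
    by (intro pair_measure_countable countable_finite R(1))
  also have "c * c = ennreal (1 / (real N)\<^sup>2)"
    by (simp add: c_def power2_eq_square flip: ennreal_mult)
  finally show ?thesis
    by (simp add: case_prod_unfold)
qed

definition jacobian_measure :: "nat \<Rightarrow> (complex \<times> complex) measure" where
  "jacobian_measure N = density (dirac_roots N \<Otimes>\<^sub>M dirac_roots N)
     (\<lambda>w. ennreal (1 / (128 * pi ^ 4) * (J_xy w)\<^sup>2))"

lemma sets_jacobian_measure: "sets (jacobian_measure N) = sets torus_borel"
  unfolding jacobian_measure_def sets_density
  by (simp add: dirac_roots_def torus_borel_def cong: sets_pair_measure_cong)

definition mass :: "nat \<Rightarrow> complex \<times> complex \<Rightarrow> real" where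
  "mass N w = 1 / (128 * pi ^ 4) * (J_xy w)\<^sup>2 / (real N)\<^sup>2"

lemma emeasure_jacobian_measure:
  assumes "N > 0" "A \<in> sets torus_borel"
  shows "emeasure (jacobian_measure N) A = (\<Sum>w\<in>roots N \<times> roots N. ennreal (mass N w) * indicator A w)"
proof -
  let ?h = "\<lambda>w. ennreal (1 / (128 * pi ^ 4) * (J_xy w)\<^sup>2)"
  let ?C = "count_space (roots N \<times> roots N)"
  note R = roots_facts[OF assms(1)]
  have h: "?h \<in> borel_measurable torus_borel"
    by measurable
  have coe: "(\<lambda>w. w) \<in> measurable (density ?C (\<lambda>_. ennreal (1 / (real N)\<^sup>2))) torus_borel"
    using R(3) by auto
  have "emeasure (jacobian_measure N) A =
      (\<integral>\<^sup>+w. ?h w * indicator A w \<partial>distr (density ?C (\<lambda>_. ennreal (1 / (real N)\<^sup>2))) torus_borel (\<lambda>w. w))"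
    unfolding jacobian_measure_def dirac_roots_pair[OF assms(1)]
    using h assms(2) by (intro emeasure_density) auto
  also have "\<dots> = (\<integral>\<^sup>+w. ?h w * indicator A w \<partial>density ?C (\<lambda>_. ennreal (1 / (real N)\<^sup>2)))"
    using h assms(2) by (intro nn_integral_distr coe) auto
  also have "\<dots> = (\<integral>\<^sup>+w. ennreal (1 / (real N)\<^sup>2) * (?h w * indicator A w) \<partial>?C)"
    by (intro nn_integral_density) auto
  also have "\<dots> = (\<Sum>w\<in>roots N \<times> roots N. ennreal (1 / (real N)\<^sup>2) * (?h w * indicator A w))"
    using R(1) by (intro nn_integral_count_space_finite) auto
  also have "\<dots> = (\<Sum>w\<in>roots N \<times> roots N. ennreal (mass N w) * indicator A w)"
  proof (intro sum.cong refl)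
    fix w
    have "ennreal (1 / (real N)\<^sup>2) * ?h w = ennreal (mass N w)"
      unfolding mass_def by (subst ennreal_mult[symmetric]) (auto simp: mult.commute)
    then show "ennreal (1 / (real N)\<^sup>2) * (?h w * indicator A w) = ennreal (mass N w) * indicator A w"
      by (simp add: mult.assoc[symmetric])
  qed
  finally show ?thesis .
qed

lemma integral_jacobian_measure:
  fixes f :: "complex \<times> complex \<Rightarrow> real"
  assumes "N > 0" "f \<in> borel_measurable torus_borel"
  shows "(\<integral>w. f w \<partial>jacobian_measure N) = (\<Sum>w\<in>roots N \<times> roots N. mass N w * f w)"
proof -
  let ?h = "\<lambda>w. 1 / (128 * pi ^ 4) * (J_xy w)\<^sup>2"
  let ?C = "count_space (roots N \<times> roots N)"
  let ?D = "density ?C (\<lambda>_. ennreal (1 / (real N)\<^sup>2))"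
  note R = roots_facts[OF assms(1)]
  have h: "?h \<in> borel_measurable torus_borel"
    by measurable
  have coe: "(\<lambda>w. w) \<in> measurable ?D torus_borel"
    using R(3) by auto
  have "(\<integral>w. f w \<partial>jacobian_measure N) = (\<integral>w. ?h w *\<^sub>R f w \<partial>distr ?D torus_borel (\<lambda>w. w))"
    unfolding jacobian_measure_def dirac_roots_pair[OF assms(1)]
    using h assms(2) by (intro integral_density) auto
  also have "\<dots> = (\<integral>w. ?h w *\<^sub>R f w \<partial>?D)"
    using h assms(2) by (intro integral_distr coe) auto
  also have "\<dots> = (\<integral>w. (1 / (real N)\<^sup>2) *\<^sub>R (?h w *\<^sub>R f w) \<partial>?C)"
    by (intro integral_density) auto
  also have "\<dots> = (\<Sum>w\<in>roots N \<times> roots N. (1 / (real N)\<^sup>2) *\<^sub>R (?h w *\<^sub>R f w))"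
    using R(1) by (intro lebesgue_integral_count_space_finite) auto
  finally show ?thesis
    by (simp add: mass_def mult.commute)
qed

lemma finite_measure_jacobian_measure:
  assumes "N > 0"
  shows "finite_measure (jacobian_measure N)"
proof (rule finite_measureI)
  have "space (jacobian_measure N) = space torus_borel"
    by (rule sets_eq_imp_space_eq[OF sets_jacobian_measure])
  then have "emeasure (jacobian_measure N) (space (jacobian_measure N)) =
      (\<Sum>w\<in>roots N \<times> roots N. ennreal (mass N w) * indicator (space torus_borel) w)"
    by (simp only: emeasure_jacobian_measure[OF assms sets.top])
  also have "\<dots> < \<infinity>"
    using roots_facts(1)[OF assms] by (auto simp: indicator_def)
  finally show "emeasure (jacobian_measure N) (space (jacobian_measure N)) \<noteq> \<infinity>"
    by simp
qed

lemma AE_jacobian_measure: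
  assumes "N > 0"
  shows "AE w in jacobian_measure N. w \<in> roots N \<times> roots N"
proof -
  have A: "torus - roots N \<times> roots N \<in> sets torus_borel"
    using roots_facts[OF assms] finite_in_sets_torus[of "roots N \<times> roots N"]
      sets.compl_sets[of "roots N \<times> roots N" torus_borel] by force
  have "emeasure (jacobian_measure N) (torus - roots N \<times> roots N) = 0"
    unfolding emeasure_jacobian_measure[OF assms A] by (rule sum.neutral) simp
  moreover have "space (jacobian_measure N) = torus"
    using sets_eq_imp_space_eq[OF sets_jacobian_measure] by simp
  ultimately show ?thesis
    using A by (intro AE_I[of _ _ "torus - roots N \<times> roots N"]) (auto simp: sets_jacobian_measure)
qed

text \<open>The point masses depend on the squared Jacobian alone, so a permutation of the support that
  preserves it preserves the measure.\<close>

lemma distr_jacobian_measure: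
  assumes "N > 0" "g \<in> measurable torus_borel torus_borel"
    and "bij_betw g (roots N \<times> roots N) (roots N \<times> roots N)"
    and "\<And>w. w \<in> torus \<Longrightarrow> (J_xy (g w))\<^sup>2 = (J_xy w)\<^sup>2"
  shows "distr (jacobian_measure N) (jacobian_measure N) g = jacobian_measure N"
proof (rule measure_eqI)
  have g: "g \<in> measurable (jacobian_measure N) (jacobian_measure N)"
    using assms(2) by (simp add: measurable_cong_sets[OF sets_jacobian_measure sets_jacobian_measure])
  have sp: "space (jacobian_measure N) = space torus_borel"
    by (rule sets_eq_imp_space_eq[OF sets_jacobian_measure])
  note R = roots_facts[OF assms(1)]
  fix A
  assume "A \<in> sets (distr (jacobian_measure N) (jacobian_measure N) g)"
  then have A: "A \<in> sets torus_borel" "A \<in> sets (jacobian_measure N)"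
    by (simp_all add: sets_jacobian_measure)
  have "emeasure (distr (jacobian_measure N) (jacobian_measure N) g) A =
      emeasure (jacobian_measure N) (g -` A \<inter> space torus_borel)"
    using g A(2) by (simp add: emeasure_distr sp)
  also have "\<dots> = (\<Sum>w\<in>roots N \<times> roots N. ennreal (mass N w) * indicator (g -` A \<inter> space torus_borel) w)"
    by (rule emeasure_jacobian_measure[OF assms(1) measurable_sets[OF assms(2) A(1)]])
  also have "\<dots> = (\<Sum>w\<in>roots N \<times> roots N. ennreal (mass N (g w)) * indicator A (g w))"
  proof (intro sum.cong refl)
    fix w
    assume "w \<in> roots N \<times> roots N"
    then have "w \<in> torus"
      using R(3) by blast
    then show "ennreal (mass N w) * indicator (g -` A \<inter> space torus_borel) w =
        ennreal (mass N (g w)) * indicator A (g w)"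
      by (auto simp: mass_def assms(4) indicator_def)
  qed
  also have "\<dots> = (\<Sum>w\<in>roots N \<times> roots N. ennreal (mass N w) * indicator A w)"
    by (rule sum.reindex_bij_betw[OF assms(3)])
  also have "\<dots> = emeasure (jacobian_measure N) A"
    by (rule emeasure_jacobian_measure[OF assms(1) A(1), symmetric])
  finally show "emeasure (distr (jacobian_measure N) (jacobian_measure N) g) A = emeasure (jacobian_measure N) A" .
qed simp

lemma D8_invariant_jacobian_measure:
  assumes "N > 0"
  shows "D8_invariant (jacobian_measure N)"
  unfolding D8_invariant_iff[OF sets_jacobian_measure]
proof
  show "distr (jacobian_measure N) (jacobian_measure N) swap_map = jacobian_measure N"
  proof (rule distr_jacobian_measure[OF assms measurable_swap_map])
    show "bij_betw swap_map (roots N \<times> roots N) (roots N \<times> roots N)"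
      by (rule bij_betw_byWitness[where f' = swap_map]) auto
    show "(J_xy (swap_map w))\<^sup>2 = (J_xy w)\<^sup>2" if "w \<in> torus" for w
      using that by (auto simp: J_xy_on_torus power_mult_distrib power2_commute)
  qed
  show "distr (jacobian_measure N) (jacobian_measure N) rot_map = jacobian_measure N"
  proof (rule distr_jacobian_measure[OF assms measurable_rot_map])
    show "bij_betw rot_map (roots N \<times> roots N) (roots N \<times> roots N)"
      by (rule bij_betw_byWitness[where f' = "\<lambda>(a, b). (inverse b, a)"]) (auto simp: power_inverse)
    show "(J_xy (rot_map w))\<^sup>2 = (J_xy w)\<^sup>2" if "w \<in> torus" for w
      using that by (auto simp: J_xy_on_torus norm_inverse inverse_on_circle power_mult_distrib power2_commute)
  qed
qed

text \<open>Writing the roots of unity as \<open>cis (pi * j / K)\<close> gives the unfolded sum over pairs of residues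
  that the moments of the graphs were reduced to. The constants agree because
  \<open>(32 * pi\<^sup>2)\<^sup>2 / (128 * pi ^ 4) / (2 * K)\<^sup>2 = 2 / K\<^sup>2\<close>.\<close>

lemma jacobian_measure_moment:
  "(\<integral>w. chi_x w ^ m * chi_y w ^ n \<partial>jacobian_measure (2 * (k + 3))) =
    joint_moment (A_graph k rho_x) (A_graph k rho_y) m n"
proof -
  define K where "K = k + 3"
  define N where "N = 2 * K"
  define \<omega> where "\<omega> j = cis (angle K j)" for j
  define G where "G w = mass N w * (fst (re_chi w) ^ m * snd (re_chi w) ^ n)" for w
  have N: "N > 0"
    by (simp add: N_def K_def)
  have \<omega>: "bij_betw \<omega> {..<N} (roots N)"
  proof -
    have "\<omega> = (\<lambda>j. cis (2 * pi * real j / real N))"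
      by (simp add: \<omega>_def angle_def N_def fun_eq_iff)
    then show ?thesis
      using Complex.bij_betw_roots_unity[OF N] by simp
  qed
  have "(\<integral>w. fst (re_chi w) ^ m * snd (re_chi w) ^ n \<partial>jacobian_measure N) = (\<Sum>w\<in>roots N \<times> roots N. G w)"
    unfolding G_def by (rule integral_jacobian_measure[OF N]) measurable
  also have "\<dots> = (\<Sum>a\<in>roots N. \<Sum>b\<in>roots N. G (a, b))"
    by (simp add: sum.cartesian_product)
  also have "\<dots> = (\<Sum>i<N. \<Sum>j<N. G (\<omega> i, \<omega> j))"
    unfolding sum.reindex_bij_betw[OF \<omega>, symmetric] ..
  also have "\<dots> = (\<Sum>i<N. \<Sum>j<N. 2 / (real K)\<^sup>2 *
      ((sin (angle K i) * sin (angle K j) * (cos (angle K i) - cos (angle K j)))\<^sup>2 *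
       ((2 * cos (angle K i) + 2 * cos (angle K j)) ^ m * (1 + 4 * cos (angle K i) * cos (angle K j)) ^ n)))"
  proof (intro sum.cong refl)
    fix i j
    define q where "q = sin (angle K i) * sin (angle K j) * (cos (angle K i) - cos (angle K j))"
    have J: "J_xy (\<omega> i, \<omega> j) = 32 * pi\<^sup>2 * q"
      by (simp add: J_xy_on_torus \<omega>_def q_def)
    have "mass N (\<omega> i, \<omega> j) = 2 / (real K)\<^sup>2 * q\<^sup>2"
      unfolding mass_def J N_def by (simp add: power_mult_distrib field_simps flip: power_mult)
    then show "G (\<omega> i, \<omega> j) = 2 / (real K)\<^sup>2 *
      ((sin (angle K i) * sin (angle K j) * (cos (angle K i) - cos (angle K j)))\<^sup>2 *
       ((2 * cos (angle K i) + 2 * cos (angle K j)) ^ m * (1 + 4 * cos (angle K i) * cos (angle K j)) ^ n))"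
      by (simp add: G_def re_chi_def \<omega>_def q_def)
  qed
  finally show ?thesis
    unfolding integral_moment[OF sets_jacobian_measure] joint_moment_sum
    by (simp only: K_def[symmetric] N_def[symmetric] sum_distrib_left)
qed

theorem theorem4p2:
  fixes k :: nat and M :: "(complex \<times> complex) measure"
  assumes "k \<ge> 1"
  shows "is_joint_spectral_measure (A_graph k rho_x) (A_graph k rho_y) M \<longleftrightarrow>
         M = density (dirac_roots (2 * (k + 3)) \<Otimes>\<^sub>M dirac_roots (2 * (k + 3)))
               (\<lambda>w. ennreal (1 / (128 * pi ^ 4) * (J_xy w)\<^sup>2))"
proof -
  define N where "N = 2 * (k + 3)"
  have N: "N > 0"
    by (simp add: N_def)
  note R = roots_facts[OF N]
  have spectral: "is_joint_spectral_measure (A_graph k rho_x) (A_graph k rho_y) (jacobian_measure N)"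
    unfolding is_joint_spectral_measure_def
    by (intro conjI allI sets_jacobian_measure finite_measure_jacobian_measure[OF N]
        D8_invariant_jacobian_measure[OF N]) (unfold N_def, rule jacobian_measure_moment)
  have "M = jacobian_measure N" if "is_joint_spectral_measure (A_graph k rho_x) (A_graph k rho_y) M"
    using that spectral unfolding is_joint_spectral_measure_def
    by (intro D8_invariant_measure_determined[where F = "roots N \<times> roots N"] finite_cartesian_product
        R(1) Sigma_mono R(3) AE_jacobian_measure[OF N]) auto
  with spectral show ?thesis
    unfolding jacobian_measure_def[symmetric] N_def[symmetric] by blast
qed

end
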